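(* The set $\mathcal{A}dm^+_{SO^*(2n)}$ of dominant, indivisible, $\mathfrak{p}^-$-admissible one-parameter subgroups associated to $G=SO^*(2n)$ is $$\{(1,0,\dots,0),(0,\dots,0,-1)\}\cup\{\lambda_{k,n-k}:k=1,\dots,n-1\}\cup\{\lambda_{k,l}:k=1,\dots,n-4,\ l=1,\dots,n-k-3\}$$ when $n\ge4$, and $\mathcal{A}dm^+_{SO^*(6)}=\{(1,-1,-1),(1,1,-1)\}$ (case $n=3$). Here $\lambda_{k,l}=(\underbrace{1,\dots,1}_{k},\underbrace{0,\dots,0}_{n-(k+l)},\underbrace{-1,\dots,-1}_{l})$.
   Context: For $G=SO^*(2n)$, $n\ge3$, the maximal compact subgroup is $K\cong U(n)$, with complexification $GL_n(\mathbb{C})$; $T_{\mathbb{C}}$ is the torus of diagonal matrices of $GL_n(\mathbb{C})$. A one-parameter subgroup of $T_{\mathbb{C}}$ is $\lambda=(\lambda_1,\dots,\lambda_n)\in\mathbb{Z}^n$, i.e. $t\mapsto\mathrm{diag}(t^{\lambda_1},\dots,t^{\lambda_n})$. It is dominant if $\lambda_1\ge\dots\ge\lambda_n$, and indivisible if it is not $n'\lambda'$ with $n'>1$ an integer and $\lambda'\in\mathbb{Z}^n$. $\mathfrak{p}^-\cong\wedge^2((\mathbb{C}^n)^* )$ as a $U(n)$-module; its $T_{\mathbb{C}}$-weights are $-(e_i^*+e_j^* )$, $1\le i<j\le n$. $\lambda$ is $\mathfrak{p}^-$-admissible if there is $v\in\mathfrak{p}^-$ such that $\lambda(\mathbb{C}^*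 )$ is the identity component of the stabilizer of $v$ in $T_{\mathbb{C}}$; equivalently, the line $\mathbb{C}\lambda\subset\mathfrak{t}_{\mathbb{C}}$ is the intersection of the kernels of a family of weights of $\mathfrak{p}^-$. *)

theory Defs
  imports "HOL-Analysis.Analysis"
begin

text \<open>
  The coordinates 1, ..., n are the elements of a finite linearly ordered type \<open>'n\<close>,
  with \<open>n = CARD('n)\<close>.  A one-parameter subgroup of the torus is identified with its
  vector of exponents \<open>a :: int ^ 'n\<close>.

  In the realization of the complexified Lie algebra \<open>so(2n, C)\<close> of \<open>SO\<^sup>*(2n)\<close> by the
  split quadratic form, its elements are the block matrices
  \<open>(A, B; C, -A\<^sup>T)\<close> with \<open>B\<close> and \<open>C\<close> skew-symmetric, \<open>GL\<^sub>n(C)\<close> is embedded by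
  \<open>g \<mapsto> diag(g, g\<^sup>-\<^sup>T)\<close>, and \<open>\<pp>\<^sup>-\<close> is the space of the \<open>(0, 0; C, 0)\<close>.  The adjoint action on the
  block \<open>C\<close> is \<open>C \<mapsto> g\<^sup>-\<^sup>T C g\<^sup>-\<^sup>1\<close>, which is the natural action on alternating bilinear
  forms on \<open>C\<^sup>n\<close>, that is, on the exterior square of the dual of \<open>C\<^sup>n\<close>.
\<close>

definition p_minus :: "(complex ^ 'n ^ 'n) set"
  where "p_minus = {v. transpose v = - v}"

definition gl_act :: "complex ^ 'n ^ 'n \<Rightarrow> complex ^ 'n ^ 'n \<Rightarrow> complex ^ 'n ^ 'n"
  where "gl_act g v = transpose (matrix_inv g) ** v ** matrix_inv g"

definition torus :: "(complex ^ 'n ^ 'n) set"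
  where "torus = {g. invertible g \<and> (\<forall>i j. i \<noteq> j \<longrightarrow> g $ i $ j = 0)}"

definition torus_stabilizer :: "complex ^ 'n ^ 'n \<Rightarrow> (complex ^ 'n ^ 'n) set"
  where "torus_stabilizer v = {g \<in> torus. gl_act g v = v}"

definition one_param :: "int ^ 'n \<Rightarrow> complex \<Rightarrow> complex ^ 'n ^ 'n"
  where "one_param a t = (\<chi> i j. if i = j then t powi (a $ i) else 0)"

text \<open>The identity component is taken in the Euclidean topology; for the stabilizer, a complex
  algebraic group, it coincides with the identity component in the Zariski topology.\<close>

definition p_minus_admissible :: "int ^ 'n \<Rightarrow> bool"
  where "p_minus_admissible a \<longleftrightarrow>
    (\<exists>v \<in> p_minus. one_param a ` (- {0}) = connected_component_set (torus_stabilizer v) (mat 1))"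

definition dominant :: "int ^ ('n :: {finite, linorder}) \<Rightarrow> bool"
  where "dominant a \<longleftrightarrow> (\<forall>i j. i \<le> j \<longrightarrow> a $ i \<ge> a $ j)"

definition indivisible :: "int ^ 'n \<Rightarrow> bool"
  where "indivisible a \<longleftrightarrow> \<not> (\<exists>m > 1. \<exists>\<mu>. a = m *s \<mu>)"

definition Adm_plus :: "(int ^ ('n :: {finite, linorder})) set"
  where "Adm_plus = {a. dominant a \<and> indivisible a \<and> p_minus_admissible a}"

text \<open>The vector with the given entries in increasing order of the coordinates; it is used only
  for lists of length \<open>CARD('n)\<close>.\<close>

definition vec_of :: "int list \<Rightarrow> int ^ ('n :: {finite, linorder})"
  where "vec_of xs = (\<chi> i. xs ! card {j. j < i})"

definition lambda_kl :: "nat \<Rightarrow> nat \<Rightarrow> int ^ ('n :: {finite, linorder})"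
  where "lambda_kl k l =
    vec_of (replicate k 1 @ replicate (CARD('n) - (k + l)) 0 @ replicate l (- 1))"

text \<open>The entry \<open>(i, j)\<close> of an element of \<open>\<pp>\<^sup>-\<close> has weight \<open>-(e\<^sub>i\<^sup>* + e\<^sub>j\<^sup>*)\<close>.\<close>

lemma gl_act_torus_nth:
  fixes g v :: "complex ^ 'n ^ 'n"
  assumes "g \<in> torus"
  shows "gl_act g v $ i $ j = inverse (g $ i $ i) * inverse (g $ j $ j) * v $ i $ j"
proof -
  have inv: "invertible g" and off: "\<And>i j. i \<noteq> j \<Longrightarrow> g $ i $ j = 0"
    using assms by (auto simp: torus_def)
  define h :: "complex ^ 'n ^ 'n" where "h = (\<chi> i j. if i = j then inverse (g $ i $ i) else 0)"
  have gh: "g ** B = (\<chi> i j. g $ i $ i * B $ i $ j)" for B :: "complex ^ 'n ^ 'n"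
  proof -
    have "(\<Sum>k\<in>UNIV. g $ i $ k * B $ k $ j) = (\<Sum>k\<in>UNIV. if k = i then g $ i $ i * B $ i $ j else 0)" for i j
      by (rule sum.cong) (auto simp: off)
    then show ?thesis by (simp add: matrix_matrix_mult_def)
  qed
  have nz: "g $ i $ i \<noteq> 0" for i
  proof
    assume "g $ i $ i = 0"
    moreover obtain B where "g ** B = mat 1" using inv by (auto simp: invertible_def)
    then have "(g ** B) $ i $ i = 1" by (simp add: mat_def)
    ultimately show False by (simp add: gh)
  qed
  have "g ** h = mat 1"
    by (auto simp: gh h_def mat_def vec_eq_iff nz)
  moreover have "matrix_inv g ** g = mat 1"
    using inv unfolding invertible_def matrix_inv_def by (rule someI2_ex) blast
  ultimately have "matrix_inv g = h"
    by (metis matrix_mul_assoc matrix_mul_lid matrix_mul_rid)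
  then show ?thesis
    by (simp add: gl_act_def h_def matrix_matrix_mult_def transpose_def
        if_distrib if_distribR cong: if_cong)
qed

end

theory Submission
  imports Defs
begin

text \<open>
  A skew-symmetric \<open>v\<close> is a graph on the coordinates, with an edge wherever \<open>v\<close> is nonzero, and
  its stabilizer in the torus consists of the \<open>g\<close> with \<open>g\<^sub>i g\<^sub>j = 1\<close> on every edge.
  If its identity component is the image of \<open>a\<close>, then every integer vector \<open>b\<close> with
  \<open>b\<^sub>i + b\<^sub>j = 0\<close> on the edges is proportional to \<open>a\<close>.  Testing this with the vector that is
  \<open>1\<close> where \<open>a = c\<close>, \<open>-1\<close> where \<open>a = -c\<close> and \<open>0\<close> elsewhere shows that an indivisible \<open>a\<close> has entries
  in \<open>{1, 0, -1}\<close>; testing it with \<open>e\<^sub>i\<close> and \<open>e\<^sub>i - e\<^sub>j\<close> shows that the zero set does not have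
  one or two elements and that \<open>a\<close> is a unit vector up to sign if it does not take both
  values \<open>1\<close> and \<open>-1\<close>.  Conversely, for such an \<open>a\<close> join every coordinate of value \<open>1\<close> to every
  coordinate of value \<open>-1\<close> and take the complete graph on the zero set: since that set is
  empty or has three elements, the entries of \<open>g\<close> on it are \<open>\<plusminus>1\<close>, hence \<open>1\<close> on the identity component.
\<close>

section \<open>Torus stabilizers and one-parameter subgroups in coordinates\<close>

lemma torus_iff: "g \<in> torus \<longleftrightarrow> (\<forall>i. g $ i $ i \<noteq> 0) \<and> (\<forall>i j. i \<noteq> j \<longrightarrow> g $ i $ j = 0)"
  for g :: "complex ^ 'n ^ 'n"
proof (cases "\<forall>i j. i \<noteq> j \<longrightarrow> g $ i $ j = 0")
  case True
  then have "det g = (\<Prod>i\<in>UNIV. g $ i $ i)"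
    by (intro det_diagonal) auto
  then show ?thesis
    using True by (auto simp: torus_def invertible_det_nz)
qed (auto simp: torus_def)

lemma torus_stabilizer_iff:
  "g \<in> torus_stabilizer v \<longleftrightarrow>
    g \<in> torus \<and> (\<forall>i j. v $ i $ j \<noteq> 0 \<longrightarrow> g $ i $ i * g $ j $ j = 1)"
  for g :: "complex ^ 'n ^ 'n"
proof -
  have "gl_act g v = v \<longleftrightarrow> (\<forall>i j. v $ i $ j \<noteq> 0 \<longrightarrow> g $ i $ i * g $ j $ j = 1)" if g: "g \<in> torus"
  proof -
    have nz: "g $ i $ i \<noteq> 0" for i
      using g by (simp add: torus_iff)
    have "inverse (g $ i $ i) * inverse (g $ j $ j) * v $ i $ j = v $ i $ j \<longleftrightarrow>
        (v $ i $ j \<noteq> 0 \<longrightarrow> g $ i $ i * g $ j $ j = 1)" for i j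
      using nz[of i] nz[of j] by (auto simp: field_simps)
    then show ?thesis
      by (simp add: vec_eq_iff gl_act_torus_nth[OF g])
  qed
  then show ?thesis
    by (auto simp: torus_stabilizer_def)
qed

lemma one_param_nth: "one_param a t $ i $ j = (if i = j then t powi (a $ i) else 0)"
  by (simp add: one_param_def)

lemma one_param_mem_stabilizer:
  assumes "\<And>i j. v $ i $ j \<noteq> 0 \<Longrightarrow> b $ i + b $ j = 0" and "t \<noteq> 0"
  shows "one_param b t \<in> torus_stabilizer v"
  using assms by (auto simp: torus_stabilizer_iff torus_iff one_param_nth simp flip: power_int_add)

text \<open>The punctured plane is connected, so its image is a connected part of the stabilizer,
  through \<open>mat 1\<close> at parameter 1.\<close>

lemma one_param_subset_component:
  fixes v :: "complex ^ 'n ^ 'n"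
  assumes "\<And>i j. v $ i $ j \<noteq> 0 \<Longrightarrow> b $ i + b $ j = 0"
  shows "one_param b ` (- {0}) \<subseteq> connected_component_set (torus_stabilizer v) (mat 1)"
proof (rule connected_component_maximal)
  have "mat 1 = one_param b 1"
    by (simp add: vec_eq_iff one_param_nth mat_def)
  then show "mat 1 \<in> one_param b ` (- {0})"
    by auto
  have "continuous_on (- {0}) (\<lambda>t. one_param b t)"
    unfolding one_param_def
  proof (intro continuous_on_vec_lambda)
    show "continuous_on (- {0}) (\<lambda>t :: complex. if i = j then t powi b $ i else 0)" for i j
      by (cases "i = j") (auto intro!: continuous_intros)
  qed
  moreover have "connected (- {0 :: complex})"
    by (rule connected_punctured_universe) simp
  ultimately show "connected (one_param b ` (- {0}))"
    by (rule connected_continuous_image)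
  show "one_param b ` (- {0}) \<subseteq> torus_stabilizer v"
    using one_param_mem_stabilizer[OF assms] by auto
qed

text \<open>The single point \<open>one_param b 2\<close> suffices: if it equals
  \<open>one_param a s\<close>, logarithms of the moduli of the diagonal entries give the factor ln
  |s| / ln 2.\<close>

lemma one_param_image_subset_imp_proportional:
  fixes a b :: "int ^ 'n"
  assumes "one_param b ` (- {0}) \<subseteq> one_param a ` (- {0})"
  obtains r :: real where "\<And>i. of_int (b $ i) = r * of_int (a $ i)"
proof -
  have "one_param b 2 \<in> one_param a ` (- {0})"
    using assms by auto
  then obtain s where s: "s \<noteq> 0" "one_param b 2 = one_param a s"
    by auto
  have "of_int (b $ i) = ln (cmod s) / ln 2 * of_int (a $ i)" for i
  proof -
    have "(2 :: complex) powi (b $ i) = s powi (a $ i)"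
      using arg_cong[OF s(2), of "\<lambda>g. g $ i $ i"] by (simp add: one_param_nth)
    then have "2 powi (b $ i) = cmod s powi (a $ i)"
      by (metis norm_power_int norm_numeral)
    then have "of_int (b $ i) * ln 2 = of_int (a $ i) * ln (cmod s)"
      using s(1) by (metis ln_powr powr_real_of_int' zero_le_numeral norm_ge_zero
          zero_less_numeral zero_less_norm_iff less_irrefl)
    then show ?thesis
      by (simp add: field_simps)
  qed
  then show thesis
    by (rule that)
qed

section \<open>Indivisible vectors\<close>

lemma indivisible_nonzero:
  assumes "indivisible a"
  obtains i where "a $ i \<noteq> 0"
proof -
  have "a \<noteq> 2 *s 0"
    using assms unfolding indivisible_def by (metis one_less_numeral_iff semiring_norm(76))
  then show thesis
    using that by (auto simp: vec_eq_iff)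
qed

lemma indivisible_abs_le_1:
  assumes "indivisible a" and "\<And>i. c dvd a $ i"
  shows "\<bar>c\<bar> \<le> 1"
proof (rule ccontr)
  assume "\<not> \<bar>c\<bar> \<le> 1"
  moreover have "a = \<bar>c\<bar> *s (\<chi> i. a $ i div \<bar>c\<bar>)"
    using assms(2) by (simp add: vec_eq_iff)
  ultimately show False
    using assms(1) unfolding indivisible_def by (metis not_le)
qed

lemma indivisible_unit_entry:
  assumes "\<bar>a $ i\<bar> = 1"
  shows "indivisible a"
  unfolding indivisible_def
proof safe
  fix m :: int and \<mu> :: "int ^ 'a"
  assume "m > 1" "a = m *s \<mu>"
  then have "m dvd a $ i"
    by simp
  then show False
    using assms \<open>m > 1\<close> zdvd_not_zless by (metis dvd_abs_iff zero_less_one)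
qed

section \<open>Necessary conditions for admissibility\<close>

lemma p_minus_admissible_imp:
  fixes a :: "int ^ 'n"
  assumes ind: "indivisible a" and adm: "p_minus_admissible a"
  shows "a $ i \<in> {1, 0, -1}"
    and "card {i. a $ i = 0} \<notin> {1, 2}"
    and "{i. a $ i = 1} \<noteq> {} \<and> {i. a $ i = -1} \<noteq> {} \<or>
      card {i. a $ i = 1} + card {i. a $ i = -1} = 1"
proof -
  obtain v where "v \<in> p_minus" and
    eq: "one_param a ` (- {0}) = connected_component_set (torus_stabilizer v) (mat 1)"
    using adm by (auto simp: p_minus_admissible_def)
  have skew: "v $ j $ i = - v $ i $ j" for i j
  proof -
    have "transpose v $ i $ j = (- v) $ i $ j"
      using \<open>v \<in> p_minus\<close> by (simp only: p_minus_def mem_Collect_eq)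
    then show ?thesis
      by (simp add: transpose_def)
  qed
  have diag: "v $ i $ i = 0" for i
    using skew[of i i] by simp
  have multiple: "\<exists>r :: real. \<forall>i. of_int (b $ i) = r * of_int (a $ i)"
    if "\<And>i j. v $ i $ j \<noteq> 0 \<Longrightarrow> b $ i + b $ j = 0" for b
    using one_param_image_subset_imp_proportional[of b a] one_param_subset_component[of v b] that
    unfolding eq by metis
  \<comment> \<open>The number 2 is not a root of unity, so stabilizing \<open>v\<close> at
    parameter 2 already forces the exponent to vanish.\<close>
  have edge: "a $ i + a $ j = 0" if "v $ i $ j \<noteq> 0" for i j
  proof -
    have "one_param a 2 \<in> one_param a ` (- {0})"
      by auto
    then have "one_param a 2 \<in> torus_stabilizer v"
      using connected_component_subset unfolding eq by blast
    then have "(2 :: complex) powi (a $ i) * 2 powi (a $ j) = 1"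
      using that by (simp add: torus_stabilizer_iff one_param_nth)
    then have "(2 :: complex) powi (a $ i + a $ j) = 1"
      by (simp add: power_int_add)
    then have "(2 :: real) powi (a $ i + a $ j) = 1"
      by (metis norm_power_int norm_numeral norm_one)
    then show ?thesis
      by (simp flip: powr_real_of_int')
  qed
  obtain i0 where i0: "a $ i0 \<noteq> 0"
    using ind by (rule indivisible_nonzero)
  define c where "c = a $ i0"
  have "c \<noteq> 0" using i0 by (simp add: c_def)
  define b :: "int ^ 'n" where "b = (\<chi> i. if a $ i = c then 1 else if a $ i = - c then -1 else 0)"
  have "b $ i + b $ j = 0" if "v $ i $ j \<noteq> 0" for i j
    using edge[OF that] \<open>c \<noteq> 0\<close> by (auto simp: b_def)
  then obtain r :: real where r: "\<And>i. of_int (b $ i) = r * of_int (a $ i)"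
    using multiple by blast
  \<comment> \<open>Hence \<open>r\<close> is 1/c and in particular nonzero, so \<open>a\<close>
    vanishes wherever \<open>b\<close> does.\<close>
  have "r * of_int c = 1"
    using r[of i0] by (simp add: b_def c_def)
  then have "a $ i \<in> {c, 0, - c}" for i
    using r[of i] \<open>c \<noteq> 0\<close> by (auto simp: b_def split: if_splits)
  moreover have "\<bar>c\<bar> \<le> 1"
    using ind
  proof (rule indivisible_abs_le_1)
    show "c dvd a $ i" for i
      using calculation[of i] by auto
  qed
  ultimately show entries: "a $ i \<in> {1, 0, -1}" for i
    using \<open>c \<noteq> 0\<close> by (smt (verit) insert_iff empty_iff)
  \<comment> \<open>An isolated vertex \<open>j\<close> puts no condition on its coordinate, so
    \<open>axis j 1\<close> is a test vector; it is a nonzero multiple of \<open>a\<close>, which is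
    therefore supported at \<open>j\<close>.\<close>
  have isolated: "i = j" if "\<And>k. v $ j $ k = 0" "a $ i \<noteq> 0" for i j
  proof -
    have "v $ k $ j = 0" for k
      using skew[of k j] that(1)[of k] by simp
    then have "axis j 1 $ k + axis j 1 $ l = (0 :: int)" if "v $ k $ l \<noteq> 0" for k l
      using that \<open>\<And>k. v $ j $ k = 0\<close> by (auto simp: axis_def)
    then obtain r :: real where r: "\<And>i. of_int (axis j 1 $ i :: int) = r * of_int (a $ i)"
      using multiple by blast
    show "i = j"
      using r[of i] r[of j] that(2) by (auto simp: axis_def split: if_splits)
  qed
  show "card {i. a $ i = 0} \<notin> {1, 2}"
  proof
    assume "card {i. a $ i = 0} \<in> {1, 2}"
    then consider z where "{i. a $ i = 0} = {z}" | z w where "{i. a $ i = 0} = {z, w}" "z \<noteq> w"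
      by (auto simp: card_1_singleton_iff card_2_iff)
    then show False
    proof cases
      case 1
      \<comment> \<open>A neighbour of a zero of \<open>a\<close> is again a zero, and the graph has
        no loops, so a unique zero is isolated.\<close>
      have "v $ z $ k = 0" for k
        using edge[of z k] diag[of z] 1 by (metis add_0 mem_Collect_eq singletonI singletonD)
      then have "i0 = z"
        using isolated i0 by blast
      then show False
        using 1 i0 by auto
    next
      case 2
      \<comment> \<open>The only possible edge at \<open>z\<close> or \<open>w\<close> joins the
        two, so this vector passes the edge test; but it is nonzero at \<open>z\<close>, where
        \<open>a\<close> vanishes.\<close>
      define b :: "int ^ 'n" where "b = (\<chi> i. if i = z then 1 else if i = w then -1 else 0)"
      have zero: "a $ i = 0 \<longleftrightarrow> i = z \<or> i = w" for i
        using 2 by auto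
      have "b $ i + b $ j = 0" if "v $ i $ j \<noteq> 0" for i j
        using edge[OF that] that diag zero[of i] zero[of j] by (auto simp: b_def)
      then obtain r :: real where r: "\<And>i. of_int (b $ i) = r * of_int (a $ i)"
        using multiple by blast
      show False
        using r[of z] zero[of z] by (simp add: b_def)
    qed
  qed
  \<comment> \<open>If the opposite of the value at \<open>i\<close> is not taken, then
    \<open>i\<close> has no neighbour and carries the whole support of \<open>a\<close>.\<close>
  have single: "{j. a $ j = a $ i} = {i} \<and> {j. a $ j = - a $ i} = {}"
    if "a $ i \<noteq> 0" "\<And>j. a $ j \<noteq> - a $ i" for i
  proof -
    have "v $ i $ k = 0" for k
      using edge[of i k] that(2)[of k] by (auto simp: add_eq_0_iff)
    then have "j = i" if "a $ j \<noteq> 0" for j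
      using isolated that by blast
    then have "a $ j = a $ i \<longleftrightarrow> j = i" for j
      using that(1) by metis
    then show ?thesis
      by (simp add: that(2))
  qed
  show "{i. a $ i = 1} \<noteq> {} \<and> {i. a $ i = -1} \<noteq> {} \<or>
      card {i. a $ i = 1} + card {i. a $ i = -1} = 1"
  proof (cases "\<exists>j. a $ j = - a $ i0")
    case True
    then show ?thesis
      using entries[of i0] i0 by auto
  next
    case False
    then show ?thesis
      using single[of i0] entries[of i0] i0 by auto
  qed
qed

section \<open>Sufficiency: a graph for each sign vector\<close>

lemma card_ge_3_obtain_third:
  assumes "card A \<ge> 3"
  obtains k where "k \<in> A" "k \<noteq> i" "k \<noteq> j"
proof -
  have "card {i, j} < card A"
    using assms by (intro le_less_trans[OF card_insert_le_m1[of 2]]) auto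
  then have "\<not> A \<subseteq> {i, j}"
    by (meson card_mono finite.emptyI finite.insertI not_le)
  then show thesis
    using that by auto
qed

lemma p_minus_admissible_signs:
  fixes a :: "int ^ ('n :: {finite, linorder})"
  assumes entries: "\<And>i. a $ i \<in> {1, 0, -1}"
    and zeros: "card {i. a $ i = 0} \<notin> {1, 2}"
    and signs: "{i. a $ i = 1} \<noteq> {} \<and> {i. a $ i = -1} \<noteq> {} \<or>
      card {i. a $ i = 1} + card {i. a $ i = -1} = 1"
  shows "p_minus_admissible a"
proof -
  \<comment> \<open>Only the support of \<open>v\<close> matters for the stabilizer; the order on
    the coordinates serves to choose signs making \<open>v\<close> skew-symmetric.\<close>
  define v :: "((complex, 'n) vec, 'n) vec" where
    "v = (\<chi> i j. if i = j \<or> a $ i + a $ j \<noteq> 0 then 0 else if i < j then 1 else -1)"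
  have v_nz: "v $ i $ j \<noteq> 0 \<longleftrightarrow> i \<noteq> j \<and> a $ i + a $ j = 0" for i j
    by (simp add: v_def)
  have "v \<in> p_minus"
    by (auto simp: v_def p_minus_def transpose_def vec_eq_iff)
  let ?C = "connected_component_set (torus_stabilizer v) (mat 1)"
  have "?C \<subseteq> one_param a ` (- {0})"
  proof
    fix g assume g: "g \<in> ?C"
    have C_sub: "?C \<subseteq> torus_stabilizer v"
      by (rule connected_component_subset)
    then have "g \<in> torus_stabilizer v"
      using g by blast
    then have nz: "g $ i $ i \<noteq> 0" and off: "i \<noteq> j \<Longrightarrow> g $ i $ j = 0"
      and edge: "i \<noteq> j \<Longrightarrow> a $ i + a $ j = 0 \<Longrightarrow> g $ i $ i * g $ j $ j = 1" for i j
      using v_nz by (auto simp: torus_stabilizer_iff torus_iff)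
    have zero: "g $ i $ i = 1" if i: "a $ i = 0" for i
    proof -
      have "card {i. a $ i = 0} \<noteq> 0"
        using i by auto
      with zeros have ge3: "card {i. a $ i = 0} \<ge> 3"
        unfolding insert_iff empty_iff by linarith
      obtain j where j: "a $ j = 0" "j \<noteq> i"
        using card_ge_3_obtain_third[OF ge3, of i i] by auto
      obtain k where k: "a $ k = 0" "k \<noteq> i" "k \<noteq> j"
        using card_ge_3_obtain_third[OF ge3, of i j] by auto
      \<comment> \<open>The triangle \<open>i\<close>, \<open>j\<close>, \<open>k\<close> forces the
        square of the entry to be 1. This is shown on all of \<open>?C\<close>, so that
        connectedness can then select the value 1 taken at \<open>mat 1\<close>.\<close>
      have pm: "h $ i $ i \<in> {1, -1}" if "h \<in> ?C" for h
      proof -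
        have "h \<in> torus_stabilizer v"
          using that C_sub by blast
        then have "h $ i $ i * h $ j $ j = 1" "h $ i $ i * h $ k $ k = 1" "h $ j $ j * h $ k $ k = 1"
          using i j k by (auto simp: torus_stabilizer_iff v_nz)
        then have "(h $ i $ i)\<^sup>2 = 1"
          by (simp add: power2_eq_square) (metis mult.assoc mult.commute mult.right_neutral)
        then show ?thesis
          by (simp add: power2_eq_1_iff)
      qed
      have "connected ((\<lambda>h. h $ i $ i) ` ?C)"
        by (intro connected_continuous_image continuous_intros connected_connected_component)
      moreover have "finite ((\<lambda>h. h $ i $ i) ` ?C)"
        by (rule finite_subset[of _ "{1, -1}"]) (use pm in auto)
      moreover have "mat 1 \<in> ?C"
        using g by (metis connected_component_refl_eq connected_component_in mem_Collect_eq)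
      then have "1 \<in> (\<lambda>h. h $ i $ i) ` ?C"
        by (intro image_eqI[of _ _ "mat 1"]) (simp_all add: mat_def)
      ultimately have "(\<lambda>h. h $ i $ i) ` ?C = {1}"
        by (metis connected_finite_iff_sing empty_iff singletonD)
      then show ?thesis
        using g by blast
    qed
    obtain i0 where i0: "a $ i0 \<noteq> 0"
      using signs by (metis (mono_tags, lifting) Collect_empty_eq card.empty add.right_neutral
          zero_neq_one neg_equal_0_iff_equal)
    \<comment> \<open>A common neighbour of opposite value determines both entries; without one,
      \<open>signs\<close> leaves a single coordinate with this value.\<close>
    have same: "g $ i $ i = g $ i0 $ i0" if "a $ i = a $ i0" for i
    proof (cases "\<exists>j. a $ j = - a $ i0")
      case True
      then obtain j where j: "a $ j = - a $ i0" ..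
      then have "j \<noteq> i" "j \<noteq> i0"
        using that i0 by auto
      then have "g $ i $ i * g $ j $ j = 1" "g $ i0 $ i0 * g $ j $ j = 1"
        using edge[of i j] edge[of i0 j] that j by auto
      then show ?thesis
        using nz[of j] by (metis mult_right_cancel)
    next
      case False
      then have "card {j. a $ j = a $ i0} = 1"
        using signs entries[of i0] i0 by auto
      then obtain m where "{j. a $ j = a $ i0} = {m}"
        by (rule card_1_singletonE)
      then have "i = m" "i0 = m"
        using that by auto
      then show ?thesis
        by simp
    qed
    \<comment> \<open>The exponent is 1 or -1, hence its own inverse, so
      \<open>s powi (a $ i0)\<close> gives back the entry of \<open>g\<close> at
      \<open>i0\<close>.\<close>
    define s where "s = g $ i0 $ i0 powi (a $ i0)"
    have "g $ i $ i = s powi (a $ i)" for i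
    proof -
      consider "a $ i = 0" | "a $ i = a $ i0" | "a $ i = - a $ i0"
        using entries[of i] entries[of i0] i0 by auto
      then show ?thesis
      proof cases
        case 1
        then show ?thesis
          using zero by simp
      next
        case 2
        then show ?thesis
          using same[OF 2] entries[of i0] i0 by (auto simp: s_def power_int_minus)
      next
        case 3
        then have "i \<noteq> i0"
          using i0 by auto
        then have "g $ i $ i * g $ i0 $ i0 = 1"
          using edge[of i i0] 3 by simp
        then have "g $ i $ i = inverse (g $ i0 $ i0)"
          by (metis inverse_unique mult.commute)
        then show ?thesis
          using 3 entries[of i0] i0 by (auto simp: s_def power_int_minus)
      qed
    qed
    then have "g = one_param a s"
      by (simp add: vec_eq_iff one_param_nth off)
    moreover have "s \<noteq> 0"
      using nz by (simp add: s_def)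
    ultimately show "g \<in> one_param a ` (- {0})"
      by blast
  qed
  moreover have "one_param a ` (- {0}) \<subseteq> ?C"
    by (rule one_param_subset_component) (simp add: v_nz)
  ultimately show ?thesis
    using \<open>v \<in> p_minus\<close> unfolding p_minus_admissible_def by blast
qed

section \<open>Positions of coordinates and dominant sign vectors\<close>

lemma strict_mono_card_less: "strict_mono (\<lambda>i :: 'n :: {finite, linorder}. card {j. j < i})"
  by (auto intro!: strict_monoI psubset_card_mono)

text \<open>\<open>card {j. j < i}\<close> is the zero-based position of \<open>i\<close>. Positions
  are distinct by monotonicity, so counting shows that all of them occur.\<close>

lemma bij_betw_card_less:
  "bij_betw (\<lambda>i :: 'n :: {finite, linorder}. card {j. j < i}) UNIV {..<CARD('n)}"
proof (rule bij_betw_imageI)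
  show inj: "inj (\<lambda>i :: 'n. card {j. j < i})"
    by (rule strict_mono_imp_inj_on[OF strict_mono_card_less])
  show "range (\<lambda>i :: 'n. card {j. j < i}) = {..<CARD('n)}"
  proof (rule card_subset_eq)
    show "range (\<lambda>i :: 'n. card {j. j < i}) \<subseteq> {..<CARD('n)}"
      by (auto intro!: psubset_card_mono)
  qed (simp_all add: card_image inj)
qed

lemma card_rank_interval:
  assumes "m \<le> CARD('n :: {finite, linorder})"
  shows "card {i :: 'n. l \<le> card {j. j < i} \<and> card {j. j < i} < m} = m - l"
proof -
  let ?r = "\<lambda>i :: 'n. card {j. j < i}"
  have inj: "inj ?r" and range: "range ?r = {..<CARD('n)}"
    using bij_betw_card_less by (auto simp: bij_betw_def)
  have "?r ` {i. l \<le> ?r i \<and> ?r i < m} = range ?r \<inter> {l..<m}"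
    by auto
  also have "\<dots> = {l..<m}"
    unfolding range using assms by auto
  finally have "card (?r ` {i. l \<le> ?r i \<and> ?r i < m}) = m - l"
    by simp
  then show ?thesis
    by (simp add: card_image inj_on_subset[OF inj])
qed

text \<open>Initial segments of a linear order are nested: \<open>{j. j < i}\<close> lies strictly
  inside \<open>D\<close> when \<open>i\<close> is in \<open>D\<close> and contains \<open>D\<close>
  otherwise, so cardinalities decide membership.\<close>

lemma rank_less_card_iff:
  fixes D :: "'n :: {finite, linorder} set"
  assumes "\<And>i j. i \<in> D \<Longrightarrow> j \<le> i \<Longrightarrow> j \<in> D"
  shows "card {j. j < i} < card D \<longleftrightarrow> i \<in> D"
proof
  assume "i \<in> D"
  then have "{j. j < i} \<subset> D"
    using assms by auto
  then show "card {j. j < i} < card D"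
    by (intro psubset_card_mono) auto
next
  assume less: "card {j. j < i} < card D"
  show "i \<in> D"
  proof (rule ccontr)
    assume "i \<notin> D"
    then have "D \<subseteq> {j. j < i}"
      using assms by (metis mem_Collect_eq not_le subsetI)
    then show False
      using less card_mono[of "{j. j < i}" D] by simp
  qed
qed

lemma lambda_kl_nth:
  fixes i :: "'n :: {finite, linorder}"
  assumes "k + l \<le> CARD('n)"
  shows "(lambda_kl k l :: (int, 'n) vec) $ i =
    (if card {j. j < i} < k then 1 else if card {j. j < i} < CARD('n) - l then 0 else -1)"
proof -
  have "card {j. j < i} < CARD('n)"
    by (intro psubset_card_mono) auto
  then show ?thesis
    using assms by (auto simp: lambda_kl_def vec_of_def nth_append)
qed

lemma card_lambda_kl:
  assumes "k + l \<le> CARD('n :: {finite, linorder})"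
  shows "card {i. (lambda_kl k l :: (int, 'n) vec) $ i = 1} = k"
    and "card {i. (lambda_kl k l :: (int, 'n) vec) $ i = 0} = CARD('n) - (k + l)"
    and "card {i. (lambda_kl k l :: (int, 'n) vec) $ i = -1} = l"
proof -
  have lt: "card {j. j < i} < CARD('n)" for i :: 'n
    by (intro psubset_card_mono) auto
  have "{i. (lambda_kl k l :: (int, 'n) vec) $ i = 1} = {i. 0 \<le> card {j. j < i} \<and> card {j. j < i} < k}"
    "{i. (lambda_kl k l :: (int, 'n) vec) $ i = 0} =
      {i. k \<le> card {j. j < i} \<and> card {j. j < i} < CARD('n) - l}"
    "{i. (lambda_kl k l :: (int, 'n) vec) $ i = -1} =
      {i. CARD('n) - l \<le> card {j. j < i} \<and> card {j. j < i} < CARD('n)}"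
    using assms lt by (auto simp: lambda_kl_nth)
  then show "card {i. (lambda_kl k l :: (int, 'n) vec) $ i = 1} = k"
    and "card {i. (lambda_kl k l :: (int, 'n) vec) $ i = 0} = CARD('n) - (k + l)"
    and "card {i. (lambda_kl k l :: (int, 'n) vec) $ i = -1} = l"
    using assms card_rank_interval[of k 0, where 'n = 'n]
    by (simp_all add: card_rank_interval)
qed

lemma dominant_lambda_kl:
  assumes "k + l \<le> CARD('n :: {finite, linorder})"
  shows "dominant (lambda_kl k l :: (int, 'n) vec)"
  unfolding dominant_def
proof (intro allI impI)
  fix i j :: 'n
  assume "i \<le> j"
  then have "card {m. m < i} \<le> card {m. m < j}"
    by (intro card_mono) auto
  then show "(lambda_kl k l :: (int, 'n) vec) $ j \<le> lambda_kl k l $ i"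
    using assms by (auto simp: lambda_kl_nth)
qed

lemma dominant_imp_eq_lambda_kl:
  fixes a :: "int ^ ('n :: {finite, linorder})"
  assumes dom: "dominant a" and entries: "\<And>i. a $ i \<in> {1, 0, -1}"
  shows "a = lambda_kl (card {i. a $ i = 1}) (card {i. a $ i = -1})"
    and "card {i. a $ i = 1} + card {i. a $ i = -1} \<le> CARD('n)"
proof -
  let ?P = "{i. a $ i = 1}" and ?N = "{i. a $ i = -1}"
  have "card ?P + card ?N = card (?P \<union> ?N)"
    by (intro card_Un_disjoint[symmetric]) auto
  also have "\<dots> \<le> CARD('n)"
    by (intro card_mono) auto
  finally show le: "card ?P + card ?N \<le> CARD('n)" .
  have anti: "a $ i \<le> a $ j" if "j \<le> i" for i j
    using dom that by (simp add: dominant_def)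
  \<comment> \<open>Dominance puts the ones first and the minus ones last, so \<open>?P\<close> and
    the complement of \<open>?N\<close> are initial segments.\<close>
  have "card {j. j < i} < card ?P \<longleftrightarrow> i \<in> ?P" for i
  proof (rule rank_less_card_iff)
    show "j \<in> ?P" if "i \<in> ?P" "j \<le> i" for i j
      using anti[OF that(2)] that(1) entries[of j] by auto
  qed
  moreover have "card {j. j < i} < card (- ?N) \<longleftrightarrow> i \<in> - ?N" for i
  proof (rule rank_less_card_iff)
    show "j \<in> - ?N" if "i \<in> - ?N" "j \<le> i" for i j
      using anti[OF that(2)] that(1) entries[of i] by auto
  qed
  ultimately show "a = lambda_kl (card ?P) (card ?N)"
    using entries by (auto simp: vec_eq_iff lambda_kl_nth[OF le] Compl_eq_Diff_UNIV card_Diff_subset)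
qed

section \<open>The classification by numbers of ones and minus ones\<close>

lemma Adm_plus_eq:
  "(Adm_plus :: (int ^ ('n :: {finite, linorder})) set) =
    {lambda_kl k l | k l. (k + l = CARD('n) \<or> k + l + 3 \<le> CARD('n)) \<and>
      (k \<ge> 1 \<and> l \<ge> 1 \<or> k + l = 1)}" (is "_ = ?R")
proof (intro equalityI subsetI)
  fix a :: "(int, 'n) vec"
  assume "a \<in> Adm_plus"
  then have dom: "dominant a" and ia: "indivisible a" "p_minus_admissible a"
    by (auto simp: Adm_plus_def)
  define k l where "k = card {i. a $ i = 1}" and "l = card {i. a $ i = -1}"
  have a: "a = lambda_kl k l" and le: "k + l \<le> CARD('n)"
    unfolding k_def l_def
    by (intro dominant_imp_eq_lambda_kl dom p_minus_admissible_imp(1) ia)+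
  \<comment> \<open>The difference counts the zeros, so there are none or at least three.\<close>
  have "CARD('n) - (k + l) \<notin> {1, 2}"
    using p_minus_admissible_imp(2)[OF ia] card_lambda_kl(2)[OF le] a by metis
  then have "k + l = CARD('n) \<or> k + l + 3 \<le> CARD('n)"
    using le by auto
  moreover have "k \<ge> 1 \<and> l \<ge> 1 \<or> k + l = 1"
    using p_minus_admissible_imp(3)[OF ia] by (auto simp: k_def l_def Suc_le_eq card_gt_0_iff)
  ultimately show "a \<in> ?R"
    using a by blast
next
  fix a :: "(int, 'n) vec"
  assume "a \<in> ?R"
  then obtain k l where a: "a = lambda_kl k l"
    and z: "k + l = CARD('n) \<or> k + l + 3 \<le> CARD('n)" and kl: "k \<ge> 1 \<and> l \<ge> 1 \<or> k + l = 1"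
    by blast
  then have le: "k + l \<le> CARD('n)"
    by auto
  note c = card_lambda_kl[OF le, folded a]
  have "{i. a $ i = 1} \<noteq> {} \<or> {i. a $ i = -1} \<noteq> {}"
    using c kl by (metis card.empty add.right_neutral not_one_le_zero zero_neq_one)
  then obtain i where "a $ i = 1 \<or> a $ i = -1"
    by blast
  then have "\<bar>a $ i\<bar> = 1"
    by auto
  then have "indivisible a"
    by (rule indivisible_unit_entry)
  moreover have "p_minus_admissible a"
  proof (rule p_minus_admissible_signs)
    show "a $ i \<in> {1, 0, -1}" for i
      by (simp add: a lambda_kl_nth[OF le])
    show "card {i. a $ i = 0} \<notin> {1, 2}"
      unfolding c(2) using z by auto
    show "{i. a $ i = 1} \<noteq> {} \<and> {i. a $ i = -1} \<noteq> {} \<or>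
        card {i. a $ i = 1} + card {i. a $ i = -1} = 1"
      using c kl by (metis card.empty not_one_le_zero)
  qed
  ultimately show "a \<in> Adm_plus"
    using dominant_lambda_kl[OF le] by (simp add: Adm_plus_def a)
qed

theorem mainTheorem15:
  shows "(CARD('n) \<ge> 4 \<longrightarrow>
      (Adm_plus :: (int ^ ('n :: {finite, linorder})) set) =
        {vec_of (1 # replicate (CARD('n) - 1) 0), vec_of (replicate (CARD('n) - 1) 0 @ [- 1])}
        \<union> {lambda_kl k (CARD('n) - k) | k. k \<in> {1..CARD('n) - 1}}
        \<union> {lambda_kl k l | k l. k \<in> {1..CARD('n) - 4} \<and> l \<in> {1..CARD('n) - k - 3}})
    \<and> (CARD('n) = 3 \<longrightarrow>
      (Adm_plus :: (int ^ ('n :: {finite, linorder})) set) = {vec_of [1, - 1, - 1], vec_of [1, 1, - 1]})"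
proof (intro conjI impI)
  assume n: "CARD('n) \<ge> 4"
  have ends: "vec_of (1 # replicate (CARD('n) - 1) 0) = (lambda_kl 1 0 :: (int, 'n) vec)"
    "vec_of (replicate (CARD('n) - 1) 0 @ [- 1]) = (lambda_kl 0 1 :: (int, 'n) vec)"
    by (simp_all add: lambda_kl_def)
  \<comment> \<open>The three groups are one nonzero entry, which leaves at least three zeros since
    n is at least 4; no zeros; and both signs with at least three zeros.\<close>
  have range: "(k + l = CARD('n) \<or> k + l + 3 \<le> CARD('n)) \<and> (k \<ge> 1 \<and> l \<ge> 1 \<or> k + l = 1) \<longleftrightarrow>
    (k = 1 \<and> l = 0 \<or> k = 0 \<and> l = 1) \<or> (k \<in> {1..CARD('n) - 1} \<and> l = CARD('n) - k) \<or>
    (k \<in> {1..CARD('n) - 4} \<and> l \<in> {1..CARD('n) - k - 3})" for k l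
    by (cases k; cases l) (use n in auto)
  show "(Adm_plus :: (int, 'n) vec set) =
      {vec_of (1 # replicate (CARD('n) - 1) 0), vec_of (replicate (CARD('n) - 1) 0 @ [- 1])}
      \<union> {lambda_kl k (CARD('n) - k) | k. k \<in> {1..CARD('n) - 1}}
      \<union> {lambda_kl k l | k l. k \<in> {1..CARD('n) - 4} \<and> l \<in> {1..CARD('n) - k - 3}}"
    unfolding Adm_plus_eq range ends by auto
next
  assume n: "CARD('n) = 3"
  \<comment> \<open>For n = 3 three zeros would mean the zero vector, and one nonzero entry leaves
    the forbidden two zeros; only k + l = 3 with both signs remains.\<close>
  have range: "(k + l = CARD('n) \<or> k + l + 3 \<le> CARD('n)) \<and> (k \<ge> 1 \<and> l \<ge> 1 \<or> k + l = 1) \<longleftrightarrow>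
    k = 1 \<and> l = 2 \<or> k = 2 \<and> l = 1" for k l
    unfolding n by arith
  have ends: "vec_of [1, - 1, - 1] = (lambda_kl 1 2 :: (int, 'n) vec)"
    "vec_of [1, 1, - 1] = (lambda_kl 2 1 :: (int, 'n) vec)"
    by (simp_all add: lambda_kl_def n numeral_2_eq_2)
  show "(Adm_plus :: (int, 'n) vec set) = {vec_of [1, - 1, - 1], vec_of [1, 1, - 1]}"
    unfolding Adm_plus_eq range ends by auto
qed

end
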